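(* Let $m\ge2$ be an integer, let $X=\mathbb R^m$ with its standard inner product and norm, and let $\alpha_0,\dots,\alpha_{m-1}$ be nonnegative reals with $\sum_{i=0}^{m-1}\alpha_i=1$. Let $(g_0,\dots,g_{m-1})\in(\Gamma(X))^m$ and define $$(\forall n\ge m)\quad g_n=(\alpha_{m-1}\star g_{n-1})\,\Box\cdots\Box\,(\alpha_0\star g_{n-m}).$$ Suppose that for every $k\in\{0,\dots,m-1\}$, $g_k$ is cofinite, and that the Basic Hypothesis (see context) holds. Then $(g_n)_{n\in\mathbb N}$ epi-converges to $$g=(\lambda_{m-1}\star g_{m-1})\,\Box\cdots\Box\,(\lambda_0\star g_0).$$
   Context: $\Gamma(X)$ is the set of all functions $X\to\,]-\infty,+\infty]$ that are convex, lower semicontinuous and proper. For $g\in\Gamma(X)$: for $\alpha>0$, $(\alpha\star g)(x)=\alpha\, g(x/\alpha)$; and $0\star g=\iota_{\{0\}}$, the function equal to $0$ at $0$ and $+\infty$ elsewhere. $\Box$ is infimal convolution: $(f_1\Box\cdots\Box f_r)(x)=\inf\{f_1(x_1)+\cdots+f_r(x_r): x_1+\cdots+x_r=x\}$. The Fenchel conjugate is $g^*(x)=\sup_{y\in X}(\langle x,y\rangle-g(y))$; $g\in\Gamma(X)$ is cofinite if $g^*$ is finite everywhere on $X$. For $k\in\{0,\dots,m-1\}$: $\lambda_k=\dfrac{\sum_{i=0}^k\alpha_i}{\sum_{j=0}^{m-1}\sum_{i=0}^j\alpha_i}$. Basic Hypothesis: the polynomial $p(x)=x^m-\alpha_{m-1}x^{m-1}-\cdots-\alpha_1x-\alpha_0$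 has a unique positive root, which is simple and equal to $1$, and every other (complex) root has modulus strictly less than $1$. Epi-convergence: functions $g_n\colon X\to\,]-\infty,+\infty]$ epi-converge to $g\colon X\to\,]-\infty,+\infty]$ if for every $x\in X$: (a) for every sequence $x_n\to x$, $g(x)\le\liminf_n g_n(x_n)$; and (b) there exists a sequence $y_n\to x$ with $\limsup_n g_n(y_n)\le g(x)$. *)

theory Defs
  imports "HOL-Analysis.Analysis" "HOL-Computational_Algebra.Polynomial"
begin

(* Extended-real functions X -> ]-oo, +oo] are modelled as functions into ereal; the condition
   that -oo is not attained is stated explicitly in Gamma_set and in epi_converges. *)

definition ereal_convex :: "('a::real_vector \<Rightarrow> ereal) \<Rightarrow> bool" where
  "ereal_convex f \<longleftrightarrow>
     (\<forall>x y. \<forall>t\<in>{0<..<1::real}. f ((1 - t) *\<^sub>R x + t *\<^sub>R y) \<le> ereal (1 - t) * f x + ereal t * f y)"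

definition lower_semicont :: "('a::topological_space \<Rightarrow> ereal) \<Rightarrow> bool" where
  "lower_semicont f \<longleftrightarrow> (\<forall>x. f x \<le> Liminf (at x) f)"

definition Gamma_set :: "('a::real_normed_vector \<Rightarrow> ereal) set" where
  "Gamma_set = {f. (\<forall>x. f x \<noteq> -\<infinity>) \<and> (\<exists>x. f x \<noteq> \<infinity>) \<and> ereal_convex f \<and> lower_semicont f}"

definition indicator_zero :: "'a::zero \<Rightarrow> ereal" where
  "indicator_zero x = (if x = 0 then 0 else \<infinity>)"

(* Epi-multiplication; only used for nonnegative a. *)
definition epi_mult :: "real \<Rightarrow> ('a::real_vector \<Rightarrow> ereal) \<Rightarrow> 'a \<Rightarrow> ereal"  (infixr \<open>\<star>\<close> 75) where
  "a \<star> f = (if a = 0 then indicator_zero else (\<lambda>x. ereal a * f (x /\<^sub>R a)))"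

(* Infimal convolution of f 0, ..., f (r - 1). In ereal, \<infinity> + (-\<infinity>) = \<infinity>; this convention is
   irrelevant when the f i do not attain -\<infinity>. *)
definition inf_conv :: "nat \<Rightarrow> (nat \<Rightarrow> 'a::real_vector \<Rightarrow> ereal) \<Rightarrow> 'a \<Rightarrow> ereal" where
  "inf_conv r f x = Inf {(\<Sum>i<r. f i (y i)) | y. (\<Sum>i<r. y i) = x}"

definition fenchel_conj :: "('a::real_inner \<Rightarrow> ereal) \<Rightarrow> 'a \<Rightarrow> ereal" where
  "fenchel_conj f x = (SUP y. ereal (x \<bullet> y) - f y)"

definition cofinite_fun :: "('a::real_inner \<Rightarrow> ereal) \<Rightarrow> bool" where
  "cofinite_fun f \<longleftrightarrow> (\<forall>x. \<bar>fenchel_conj f x\<bar> \<noteq> \<infinity>)"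

definition lam :: "nat \<Rightarrow> (nat \<Rightarrow> real) \<Rightarrow> nat \<Rightarrow> real" where
  "lam m \<alpha> k = (\<Sum>i\<le>k. \<alpha> i) / (\<Sum>j<m. \<Sum>i\<le>j. \<alpha> i)"

definition recurrence_poly :: "nat \<Rightarrow> (nat \<Rightarrow> real) \<Rightarrow> real poly" where
  "recurrence_poly m \<alpha> = monom 1 m - (\<Sum>i<m. monom (\<alpha> i) i)"

definition basic_hypothesis :: "nat \<Rightarrow> (nat \<Rightarrow> real) \<Rightarrow> bool" where
  "basic_hypothesis m \<alpha> \<longleftrightarrow>
     (\<forall>x>0. poly (recurrence_poly m \<alpha>) x = 0 \<longleftrightarrow> x = 1) \<and>
     order 1 (recurrence_poly m \<alpha>) = 1 \<and>
     (\<forall>z::complex. poly (map_poly of_real (recurrence_poly m \<alpha>)) z = 0 \<and> z \<noteq> 1 \<longrightarrow> norm z < 1)"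

definition epi_converges ::
  "(nat \<Rightarrow> 'a::topological_space \<Rightarrow> ereal) \<Rightarrow> ('a \<Rightarrow> ereal) \<Rightarrow> bool" where
  "epi_converges gs g \<longleftrightarrow>
     (\<forall>n x. gs n x \<noteq> -\<infinity>) \<and> (\<forall>x. g x \<noteq> -\<infinity>) \<and>
     (\<forall>x. (\<forall>xs. xs \<longlonglongrightarrow> x \<longrightarrow> g x \<le> liminf (\<lambda>n. gs n (xs n))) \<and>
          (\<exists>ys. ys \<longlonglongrightarrow> x \<and> limsup (\<lambda>n. gs n (ys n)) \<le> g x))"

end

theory Submission
  imports Defs "HOL-Computational_Algebra.Fundamental_Theorem_Algebra"
begin

text \<open>
  The functions \<open>g n\<close> are all weighted infimal convolutions
  \<open>C(a) = (a 0 \<star> g 0) \<box> \<dots> \<box> (a (m - 1) \<star> g (m - 1))\<close> of the \<open>m\<close> starting functions, and the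
  weights obey a scalar recurrence. The proof therefore separates into a statement about the
  weights and a statement about how \<open>C(a)\<close> depends on \<open>a\<close>.

  \<^emph>\<open>Closed form.\<close> The value \<open>C(a) x\<close> is the infimum of \<open>\<Sum>k. a k * \<rho> k\<close> over all points \<open>(z k, \<rho> k)\<close> in
  the epigraphs with \<open>\<Sum>k. a k *\<^sub>R z k = x\<close>; this formula also covers the weight \<open>0\<close>, where
  \<open>0 \<star> f\<close> is the indicator of the origin
  (\<open>inf_conv_epi_mult_le\<close>, \<open>inf_conv_epi_mult_lessE\<close>). By Jensen's inequality, a
  weighted infimal convolution of \<open>C(b 0), C(b 1), \<dots>\<close> with weights \<open>\<alpha> i\<close> is \<open>C(\<Sum>i. \<alpha> i * b i)\<close>
  (\<open>inf_conv_epi_mult_compose\<close>). Hence \<open>g n = C(w n)\<close>, where \<open>w\<close> starts with the unit vectors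
  and satisfies \<open>w (n + m) = (\<Sum>i. \<alpha> i * w (n + i))\<close>.

  \<^emph>\<open>Weights.\<close> With \<open>\<beta> k = \<alpha> 0 + \<dots> + \<alpha> k\<close> the characteristic polynomial factors as
  \<open>(x - 1) q(x)\<close>, where \<open>q(x) = (\<Sum>k<m. \<beta> k * x ^ k)\<close>. The factor \<open>x - 1\<close> says that
  \<open>\<Sum>k<m. \<beta> k * u (n + k)\<close> is independent of \<open>n\<close> for every solution \<open>u\<close>. After subtracting a
  constant from \<open>u\<close> this invariant vanishes, so that \<open>q\<close>, applied to the shift operator,
  annihilates \<open>u\<close>; as all roots of \<open>q\<close> lie in the open unit disc, \<open>u\<close> tends to \<open>0\<close>. The constant is
  \<open>\<Sum>k<m. lam m \<alpha> k * u k\<close> (\<open>recurrence_tendsto_weighted_average\<close>), which gives \<open>w n k \<longlonglongrightarrow> lam m \<alpha> k\<close>.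

  \<^emph>\<open>Continuity in the weights.\<close> A cofinite function grows faster than every multiple of the norm
  (\<open>cofinite_fun_imp_supercoercive\<close>). If \<open>a n\<close> tends to \<open>l\<close> and points of the epigraphs are
  combined with weights \<open>a n\<close> to a bounded value at a convergent point, this growth makes the
  scaled points \<open>a n k *\<^sub>R z n k\<close> bounded. A subsequence converges, and its limit is again such a
  combination, now with weights \<open>l\<close>; when \<open>l k = 0\<close>, supercoercivity forces the
  \<open>k\<close>-th scaled point to tend to \<open>0\<close> (\<open>weighted_epigraph_sums_limit\<close>). This compactness
  statement yields the lower bound in the definition of epi-convergence. For constant weights it
  shows that the infimum in \<open>C(l) x\<close> is attained, and keeping the optimal points \<open>z k\<close> while
  replacing the weights \<open>l\<close> by \<open>a n\<close> gives the recovery sequence \<open>\<Sum>k. a n k *\<^sub>R z k\<close>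
  (\<open>epi_converges_inf_conv_epi_mult\<close>).
\<close>

section \<open>Linear recurrences\<close>

text \<open>This is the case of a single characteristic root \<open>r\<close>: the perturbation is eventually
  at most \<open>e / 2 * (1 - norm r)\<close>, and the geometric series sums this to \<open>e / 2\<close>.\<close>

lemma tendsto_zero_if_perturbed_contraction:
  fixes w :: "nat \<Rightarrow> 'a::real_normed_field"
  assumes r: "norm r < 1" and lim: "(\<lambda>n. w (Suc n) - r * w n) \<longlonglongrightarrow> 0"
  shows "w \<longlonglongrightarrow> 0"
proof (rule LIMSEQ_I)
  fix e :: real assume e: "e > 0"
  define \<delta> where "\<delta> = e / 2 * (1 - norm r)"
  have "\<delta> > 0" using e r by (simp add: \<delta>_def)
  from LIMSEQ_D[OF lim this] obtain N where
    N: "\<And>n. n \<ge> N \<Longrightarrow> norm (w (Suc n) - r * w n) < \<delta>" by auto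
  have bound: "norm (w (N + k)) \<le> norm r ^ k * norm (w N) + e / 2" for k
  proof (induction k)
    case 0 then show ?case using e by simp
  next
    case (Suc k)
    have "norm (w (Suc (N + k))) \<le> norm (w (Suc (N + k)) - r * w (N + k)) + norm (r * w (N + k))"
      by (metis diff_add_cancel norm_triangle_ineq)
    also have "\<dots> \<le> \<delta> + norm r * norm (w (N + k))"
      using N[of "N + k"] by (simp add: norm_mult)
    also have "\<dots> \<le> \<delta> + norm r * (norm r ^ k * norm (w N) + e / 2)"
      using Suc by (simp add: mult_left_mono)
    also have "\<dots> = norm r ^ Suc k * norm (w N) + e / 2"
      by (simp add: \<delta>_def field_simps)
    finally show ?case by simp
  qed
  have "(\<lambda>k. norm r ^ k * norm (w N)) \<longlonglongrightarrow> 0"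
    using r by (intro tendsto_mult_left_zero LIMSEQ_realpow_zero) auto
  from LIMSEQ_D[OF this, of "e/2"] e obtain K where
    K: "\<And>k. k \<ge> K \<Longrightarrow> norm r ^ k * norm (w N) < e / 2" by (auto simp: abs_mult)
  show "\<exists>no. \<forall>n\<ge>no. norm (w n - 0) < e"
  proof (intro exI allI impI)
    fix n assume "n \<ge> N + K"
    then have "N + (n - N) = n" "norm r ^ (n - N) * norm (w N) < e / 2"
      using K[of "n - N"] by simp_all
    with bound[of "n - N"] have "norm (w n) < e / 2 + e / 2" by (simp only:)
    then show "norm (w n - 0) < e" by simp
  qed
qed

text \<open>The polynomial \<open>p\<close> in the shift operator \<open>u \<mapsto> (\<lambda>n. u (Suc n))\<close>, applied to \<open>u\<close>. A sequence
  solves the linear recurrence with characteristic polynomial \<open>p\<close> iff the result is \<open>0\<close>.\<close>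
definition shift_poly :: "'a::comm_ring_1 poly \<Rightarrow> (nat \<Rightarrow> 'a) \<Rightarrow> nat \<Rightarrow> 'a" where
  "shift_poly p u n = (\<Sum>i\<le>degree p. coeff p i * u (n + i))"

lemma shift_poly_eq_sum:
  assumes "degree p \<le> N"
  shows "shift_poly p u n = (\<Sum>i\<le>N. coeff p i * u (n + i))"
  unfolding shift_poly_def using assms
  by (intro sum.mono_neutral_left) (auto simp: coeff_eq_0)

lemma shift_poly_linear_mult:
  "shift_poly ([:- r, 1:] * q) u n = shift_poly q u (Suc n) - r * shift_poly q u n"
proof -
  let ?d = "degree q"
  have "degree ([:- r, 1:] * q) \<le> Suc ?d"
    using degree_mult_le[of "[:- r, 1:]" q] by simp
  then have "shift_poly ([:- r, 1:] * q) u n = (\<Sum>i\<le>Suc ?d. coeff ([:- r, 1:] * q) i * u (n + i))"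
    by (rule shift_poly_eq_sum)
  also have "\<dots> = (\<Sum>i\<le>Suc ?d. coeff (pCons 0 q) i * u (n + i)) - r * (\<Sum>i\<le>Suc ?d. coeff q i * u (n + i))"
    by (simp add: sum_distrib_left sum_subtractf[symmetric] algebra_simps del: sum.atMost_Suc)
  also have "(\<Sum>i\<le>Suc ?d. coeff q i * u (n + i)) = shift_poly q u n"
    by (rule shift_poly_eq_sum[symmetric]) simp
  also have "(\<Sum>i\<le>Suc ?d. coeff (pCons 0 q) i * u (n + i)) = shift_poly q u (Suc n)"
    by (simp add: sum.atMost_Suc_shift shift_poly_def del: sum.atMost_Suc)
  finally show ?thesis .
qed

text \<open>The linear factors of \<open>q\<close> can be stripped off one at a time, each by the case of a single root.
  The hypothesis asks for convergence to \<open>0\<close> rather than vanishing because after the first factor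
  only convergence to \<open>0\<close> is known.\<close>
lemma tendsto_zero_if_shift_poly_tendsto_zero:
  fixes q :: "complex poly"
  assumes "q \<noteq> 0" and "\<And>z. poly q z = 0 \<Longrightarrow> norm z < 1" and "shift_poly q u \<longlonglongrightarrow> 0"
  shows "u \<longlonglongrightarrow> 0"
  using assms
proof (induction "degree q" arbitrary: q)
  case 0
  then obtain c where c: "q = [:c:]" "c \<noteq> 0" using degree_eq_zeroE[of q] by (metis pCons_0_0)
  then have "(\<lambda>n. inverse c * shift_poly q u n) = u" by (auto simp: shift_poly_def)
  with tendsto_mult_right_zero[OF 0(4), of "inverse c"] show ?case by simp
next
  case (Suc d)
  then have "\<not> constant (poly q)" by (simp add: constant_degree)
  then obtain r where r: "poly q r = 0" using fundamental_theorem_of_algebra by blast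
  then obtain q' where q': "q = [:- r, 1:] * q'" by (auto simp: poly_eq_0_iff_dvd)
  have "q' \<noteq> 0" using q' Suc.prems(1) by auto
  moreover have "degree q' = d"
    using Suc.hyps(2) \<open>q' \<noteq> 0\<close> unfolding q' by (subst (asm) degree_mult_eq) auto
  moreover have "\<And>z. poly q' z = 0 \<Longrightarrow> norm z < 1" using Suc.prems(2) q' by simp
  moreover have "shift_poly q' u \<longlonglongrightarrow> 0"
  proof (rule tendsto_zero_if_perturbed_contraction)
    show "norm r < 1" using Suc.prems(2) r by simp
    show "(\<lambda>n. shift_poly q' u (Suc n) - r * shift_poly q' u n) \<longlonglongrightarrow> 0"
      using Suc.prems(3) unfolding q' shift_poly_linear_mult[abs_def] .
  qed
  ultimately show ?case using Suc.hyps(1) by blast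
qed

text \<open>For weights \<open>a\<close> of total \<open>1\<close> this identity has two uses. With \<open>v k = z ^ k\<close> it factors \<open>z - 1\<close>
  out of the characteristic polynomial; with \<open>v k = u (n + k)\<close> it exhibits a quantity that is
  constant along every solution of the recurrence.\<close>
lemma sum_partial_sums_by_parts:
  fixes a v :: "nat \<Rightarrow> 'a::comm_ring_1"
  shows "(\<Sum>k<m. (\<Sum>i\<le>k. a i) * (v (Suc k) - v k)) = (\<Sum>i<m. a i) * v m - (\<Sum>k<m. a k * v k)"
proof (induction m)
  case (Suc m)
  have "(\<Sum>i\<le>m. a i) = (\<Sum>i<m. a i) + a m"
    by (metis lessThan_Suc_atMost sum.lessThan_Suc)
  with Suc show ?case by (simp add: algebra_simps)
qed simp

lemma poly_map_recurrence_poly: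
  "poly (map_poly of_real (recurrence_poly m \<alpha>)) (z::complex) = z ^ m - (\<Sum>i<m. of_real (\<alpha> i) * z ^ i)"
proof -
  have "map_poly of_real (recurrence_poly m \<alpha>)
      = monom 1 m - (\<Sum>i<m. monom (complex_of_real (\<alpha> i)) i)"
    by (rule poly_eqI) (auto simp: recurrence_poly_def coeff_map_poly coeff_sum coeff_monom of_real_sum
          intro!: sum.cong)
  then show ?thesis by (simp add: poly_monom poly_sum)
qed

lemma recurrence_tendsto_weighted_average:
  fixes u :: "nat \<Rightarrow> real"
  assumes nonneg: "\<And>i. i < m \<Longrightarrow> \<alpha> i \<ge> 0" and total: "(\<Sum>i<m. \<alpha> i) = 1"
    and bh: "basic_hypothesis m \<alpha>"
    and rec: "\<And>n. u (n + m) = (\<Sum>i<m. \<alpha> i * u (n + i))"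
  shows "u \<longlonglongrightarrow> (\<Sum>k<m. lam m \<alpha> k * u k)"
proof -
  define \<beta> where "\<beta> k = (\<Sum>i\<le>k. \<alpha> i)" for k
  define B where "B = (\<Sum>k<m. \<beta> k)"
  have "m > 0" using total by (cases m) auto
  have "\<beta> (m - 1) = 1" using total \<open>m > 0\<close>
    by (simp add: \<beta>_def lessThan_Suc_atMost[symmetric])
  moreover have "\<beta> k \<ge> 0" if "k < m" for k
    unfolding \<beta>_def using that by (intro sum_nonneg nonneg) auto
  ultimately have "B \<ge> 1" unfolding B_def
    using member_le_sum[of "m - 1" "{..<m}" \<beta>] \<open>m > 0\<close> by auto
  define L where "L = (\<Sum>k<m. lam m \<alpha> k * u k)"
  have L: "L * B = (\<Sum>k<m. \<beta> k * u k)"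
    using \<open>B \<ge> 1\<close>
    by (simp add: L_def lam_def \<beta>_def[symmetric] B_def[symmetric] sum_distrib_right)
  have inv: "(\<Sum>k<m. \<beta> k * u (n + k)) = L * B" for n
  proof (induction n)
    case (Suc n)
    have "(\<Sum>k<m. \<beta> k * u (Suc n + k)) - (\<Sum>k<m. \<beta> k * u (n + k)) = 0"
      using sum_partial_sums_by_parts[of \<alpha> "\<lambda>k. u (n + k)" m] rec[of n] total
      by (simp add: \<beta>_def sum_subtractf algebra_simps)
    with Suc show ?case by simp
  qed (simp add: L)
  define q where "q = (\<Sum>k<m. monom (complex_of_real (\<beta> k)) k)"
  have coeff_q: "coeff q k = (if k < m then of_real (\<beta> k) else 0)" for k
    by (auto simp: q_def coeff_sum coeff_monom)
  have poly_q: "poly q z = (\<Sum>k<m. of_real (\<beta> k) * z ^ k)" for z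
    by (simp add: q_def poly_sum poly_monom)
  have poly_q_1: "poly q 1 \<noteq> 0"
    using \<open>B \<ge> 1\<close> by (simp add: poly_q B_def of_real_sum[symmetric] del: of_real_sum)
  have roots: "norm z < 1" if "poly q z = 0" for z
  proof -
    have "poly (map_poly of_real (recurrence_poly m \<alpha>)) z
       = (\<Sum>k<m. of_real (\<beta> k) * (z ^ Suc k - z ^ k))"
      using sum_partial_sums_by_parts[of "\<lambda>i. complex_of_real (\<alpha> i)" "\<lambda>k. z ^ k" m] total
      by (simp add: poly_map_recurrence_poly \<beta>_def of_real_sum[symmetric] del: of_real_sum)
    also have "\<dots> = (z - 1) * poly q z"
      by (simp add: poly_q sum_distrib_left algebra_simps)
    finally have "poly (map_poly of_real (recurrence_poly m \<alpha>)) z = 0" using that by simp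
    moreover have "z \<noteq> 1" using that poly_q_1 by auto
    ultimately show ?thesis using bh unfolding basic_hypothesis_def by blast
  qed
  \<comment> \<open>The invariant of the shifted solution is \<open>L * B - L * B = 0\<close>, that is, \<open>q\<close> annihilates it.\<close>
  define u' where "u' n = complex_of_real (u n - L)" for n
  have "shift_poly q u' n = 0" for n
  proof -
    have "degree q \<le> m"
      by (rule degree_le) (simp add: coeff_q)
    then have "shift_poly q u' n = (\<Sum>i\<le>m. coeff q i * u' (n + i))" by (rule shift_poly_eq_sum)
    also have "\<dots> = (\<Sum>i<m. of_real (\<beta> i) * u' (n + i))"
      by (simp add: coeff_q lessThan_Suc_atMost[symmetric])
    also have "\<dots> = of_real ((\<Sum>k<m. \<beta> k * u (n + k)) - L * B)"
      by (simp add: u'_def B_def sum_distrib_left sum_subtractf algebra_simps)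
    finally show ?thesis using inv by simp
  qed
  then have "shift_poly q u' \<longlonglongrightarrow> 0" by (simp add: tendsto_eventually)
  moreover have "q \<noteq> 0" using poly_q_1 by auto
  ultimately have "u' \<longlonglongrightarrow> 0"
    using roots tendsto_zero_if_shift_poly_tendsto_zero by blast
  then have "(\<lambda>n. complex_of_real (u n - L)) \<longlonglongrightarrow> complex_of_real 0" by (simp add: u'_def[abs_def])
  then have "(\<lambda>n. u n - L) \<longlonglongrightarrow> 0" by (simp only: tendsto_of_real_iff)
  then show ?thesis by (simp add: L_def LIM_zero_iff)
qed

section \<open>Epigraphs of functions in \<open>Gamma_set\<close>\<close>

text \<open>Lower semicontinuity in \<open>lower_semicont\<close> refers to the punctured filter \<open>at x\<close>, whereas here the
  sequence may take the value \<open>x\<close>; the strict bound holds at \<open>x\<close> itself as well, so it can be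
  transferred to \<open>nhds x\<close>.\<close>
lemma Gamma_set_sequentially_closed_epigraph:
  assumes f: "f \<in> Gamma_set" and x: "xs \<longlonglongrightarrow> x" and r: "rs \<longlonglongrightarrow> r"
    and le: "\<forall>\<^sub>F n in sequentially. f (xs n) \<le> ereal (rs n)"
  shows "f x \<le> ereal r"
proof (rule ccontr)
  assume "\<not> f x \<le> ereal r"
  then obtain q where q: "ereal r < ereal q" "ereal q < f x"
    using ereal_dense2[of "ereal r" "f x"] by (meson not_le)
  have "f x \<le> Liminf (at x) f" using f by (auto simp: Gamma_set_def lower_semicont_def)
  with q have "\<forall>\<^sub>F y in at x. ereal q < f y" by (simp add: le_Liminf_iff)
  then have "\<forall>\<^sub>F y in nhds x. ereal q < f y" using q by (auto simp: eventually_nhds_conv_at)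
  then have "\<forall>\<^sub>F n in sequentially. ereal q < f (xs n)" using x by (auto simp: filterlim_iff)
  moreover have "\<forall>\<^sub>F n in sequentially. rs n < q" using r q by (auto intro: order_tendstoD)
  ultimately have "\<forall>\<^sub>F n in sequentially. False" using le
  proof eventually_elim
    case (elim n)
    then have "ereal q < ereal (rs n)" by (meson less_le_trans)
    with elim show ?case by simp
  qed
  then show False by simp
qed

lemma ereal_convex_imp_convex_epigraph:
  assumes "ereal_convex f"
  shows "convex {(x, r). f x \<le> ereal r}"
proof (rule convexI)
  fix p q and u v :: real
  assume p: "p \<in> {(x, r). f x \<le> ereal r}" and q: "q \<in> {(x, r). f x \<le> ereal r}"
    and uv: "u \<ge> 0" "v \<ge> 0" "u + v = 1"
  obtain x r y s where [simp]: "p = (x, r)" "q = (y, s)" by fastforce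
  show "u *\<^sub>R p + v *\<^sub>R q \<in> {(x, r). f x \<le> ereal r}"
  proof (cases "v = 0 \<or> v = 1")
    case True then show ?thesis using p q uv by auto
  next
    case False
    then have v: "v \<in> {0<..<1}" "u = 1 - v" using uv by auto
    have "f (u *\<^sub>R x + v *\<^sub>R y) \<le> ereal u * f x + ereal v * f y"
      using assms v by (simp add: ereal_convex_def)
    also have "\<dots> \<le> ereal u * ereal r + ereal v * ereal s"
      using p q uv by (intro add_mono ereal_mult_left_mono) auto
    finally show ?thesis by simp
  qed
qed

text \<open>This lemma and the next one parametrise the finite part of the graph of \<open>a \<star> f\<close> by that of \<open>f\<close>,
  scaled by \<open>a\<close>, uniformly in \<open>a \<ge> 0\<close>. For \<open>a = 0\<close> the graph shrinks to the origin, and every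
  point in the domain of \<open>f\<close> serves as parameter.\<close>
lemma epi_mult_le:
  assumes "a \<ge> 0" "f z \<le> ereal r"
  shows "(a \<star> f) (a *\<^sub>R z) \<le> ereal (a * r)"
proof (cases "a = 0")
  case True then show ?thesis by (simp add: epi_mult_def indicator_zero_def)
next
  case False
  then have "ereal a * f z \<le> ereal a * ereal r" using assms by (intro ereal_mult_left_mono) auto
  with False show ?thesis by (simp add: epi_mult_def)
qed

lemma epi_mult_finite_cases:
  assumes a: "a \<ge> 0" and fin: "(a \<star> f) y = ereal s" and proper: "\<And>x. f x \<noteq> - \<infinity>" "\<exists>x. f x \<noteq> \<infinity>"
  obtains z r where "f z = ereal r" "a *\<^sub>R z = y" "a * r = s"
proof (cases "a = 0")
  case True
  obtain z where "f z \<noteq> \<infinity>" using proper by blast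
  then obtain r where "f z = ereal r" using proper(1) by (metis ereal_cases)
  moreover have "y = 0" "s = 0"
    using fin True by (auto simp: epi_mult_def indicator_zero_def split: if_splits)
  ultimately show ?thesis using that True by simp
next
  case False
  then have fin': "ereal a * f (y /\<^sub>R a) = ereal s" using fin by (simp add: epi_mult_def)
  have "f (y /\<^sub>R a) \<noteq> \<infinity>"
  proof
    assume "f (y /\<^sub>R a) = \<infinity>"
    with fin' a False show False by simp
  qed
  then obtain r where "f (y /\<^sub>R a) = ereal r" using proper(1) by (metis ereal_cases)
  with fin' show ?thesis using that[of "y /\<^sub>R a" r] False by simp
qed

lemma epi_mult_not_MInfty:
  assumes "a \<ge> 0" "\<And>x. f x \<noteq> - \<infinity>"
  shows "(a \<star> f) y \<noteq> - \<infinity>"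
proof (cases "a = 0")
  case False
  have "f (y /\<^sub>R a) \<noteq> - \<infinity>" by (rule assms)
  with False assms(1) show ?thesis by (cases "f (y /\<^sub>R a)") (auto simp: epi_mult_def)
qed (simp add: epi_mult_def indicator_zero_def)

lemma inf_conv_epi_mult_le:
  assumes "\<And>k. k < r \<Longrightarrow> a k \<ge> 0" "\<And>k. k < r \<Longrightarrow> f k (z k) \<le> ereal (\<rho> k)"
    and x: "(\<Sum>k<r. a k *\<^sub>R z k) = x"
  shows "inf_conv r (\<lambda>k. a k \<star> f k) x \<le> ereal (\<Sum>k<r. a k * \<rho> k)"
proof -
  have "inf_conv r (\<lambda>k. a k \<star> f k) x \<le> (\<Sum>k<r. (a k \<star> f k) (a k *\<^sub>R z k))"
    unfolding inf_conv_def using x by (intro Inf_lower) auto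
  also have "\<dots> \<le> (\<Sum>k<r. ereal (a k * \<rho> k))"
    using assms by (intro sum_mono epi_mult_le) auto
  finally show ?thesis by (simp add: sum_ereal)
qed

text \<open>Converse of the preceding upper bound. The inequalities for \<open>\<rho>\<close> are strict so that the
  lemma can be applied once more when the \<open>f k\<close> are themselves infimal convolutions; the slack
  \<open>c - (\<Sum>k<r. a k * \<rho> k)\<close> is spread over the summands to achieve this.\<close>
lemma inf_conv_epi_mult_lessE:
  assumes a: "\<And>k. k < r \<Longrightarrow> a k \<ge> 0"
    and proper: "\<And>k x. k < r \<Longrightarrow> f k x \<noteq> - \<infinity>" "\<And>k. k < r \<Longrightarrow> \<exists>x. f k x \<noteq> \<infinity>"
    and less: "inf_conv r (\<lambda>k. a k \<star> f k) x < ereal c"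
  obtains z \<rho> where "(\<Sum>k<r. a k *\<^sub>R z k) = x" "\<And>k. k < r \<Longrightarrow> f k (z k) < ereal (\<rho> k)"
    "(\<Sum>k<r. a k * \<rho> k) < c"
proof -
  obtain y where y: "(\<Sum>k<r. y k) = x" "(\<Sum>k<r. (a k \<star> f k) (y k)) < ereal c"
    using less by (auto simp: inf_conv_def Inf_less_iff)
  have "\<exists>z \<rho>. f k z = ereal \<rho> \<and> a k *\<^sub>R z = y k \<and> ereal (a k * \<rho>) = (a k \<star> f k) (y k)" if k: "k < r" for k
  proof -
    have "(a k \<star> f k) (y k) \<noteq> \<infinity>"
      using y(2) k sum_Pinfty[of "\<lambda>k. (a k \<star> f k) (y k)" "{..<r}"] by auto
    moreover have "(a k \<star> f k) (y k) \<noteq> - \<infinity>" using a proper k by (intro epi_mult_not_MInfty) auto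
    ultimately obtain s where s: "(a k \<star> f k) (y k) = ereal s" by (metis ereal_cases)
    with epi_mult_finite_cases[OF a s] proper k show ?thesis by metis
  qed
  then obtain z \<rho> where z: "\<And>k. k < r \<Longrightarrow> f k (z k) = ereal (\<rho> k)" "\<And>k. k < r \<Longrightarrow> a k *\<^sub>R z k = y k"
    "\<And>k. k < r \<Longrightarrow> ereal (a k * \<rho> k) = (a k \<star> f k) (y k)" by metis
  have "(\<Sum>k<r. (a k \<star> f k) (y k)) = (\<Sum>k<r. ereal (a k * \<rho> k))"
    using z(3) by (intro sum.cong) auto
  then have lt: "(\<Sum>k<r. a k * \<rho> k) < c" using y(2) by (simp add: sum_ereal)
  define A where "A = (\<Sum>k<r. a k)"
  have A: "A \<ge> 0" using a by (auto simp: A_def intro: sum_nonneg)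
  \<comment> \<open>Raising every \<open>\<rho> k\<close> by \<open>\<epsilon>\<close> costs \<open>A * \<epsilon>\<close>; dividing by \<open>A + 1\<close> also covers \<open>A = 0\<close>.\<close>
  define \<epsilon> where "\<epsilon> = (c - (\<Sum>k<r. a k * \<rho> k)) / (A + 1)"
  have \<epsilon>: "\<epsilon> > 0" using lt A by (simp add: \<epsilon>_def)
  show ?thesis
  proof (rule that[of z "\<lambda>k. \<rho> k + \<epsilon>"])
    show "(\<Sum>k<r. a k *\<^sub>R z k) = x" using z(2) y(1) by simp
    show "f k (z k) < ereal (\<rho> k + \<epsilon>)" if "k < r" for k using z(1)[OF that] \<epsilon> by simp
    have "(\<Sum>k<r. a k * (\<rho> k + \<epsilon>)) = (\<Sum>k<r. a k * \<rho> k) + A * \<epsilon>"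
      by (simp add: distrib_left sum.distrib A_def sum_distrib_right)
    also have "\<dots> < (\<Sum>k<r. a k * \<rho> k) + (A + 1) * \<epsilon>" using \<epsilon> by simp
    also have "\<dots> = c" using A by (simp add: \<epsilon>_def)
    finally show "(\<Sum>k<r. a k * (\<rho> k + \<epsilon>)) < c" .
  qed
qed

section \<open>Composition of weighted infimal convolutions\<close>

lemma ereal_le_if_le_greater_reals:
  fixes x y :: ereal
  assumes "\<And>t. y < ereal t \<Longrightarrow> x \<le> ereal t"
  shows "x \<le> y"
proof (rule ccontr)
  assume "\<not> x \<le> y"
  then obtain t where "y < ereal t" "ereal t < x" using ereal_dense2[of y x] by (auto simp: not_le)
  with assms[of t] show False by simp
qed

lemma inf_conv_epi_mult_ge:
  assumes a: "\<And>k. k < r \<Longrightarrow> a k \<ge> 0"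
    and bdd: "\<And>k x. k < r \<Longrightarrow> ereal (c k) \<le> f k x" and dom: "\<And>k. k < r \<Longrightarrow> \<exists>x. f k x \<noteq> \<infinity>"
  shows "ereal (\<Sum>k<r. a k * c k) \<le> inf_conv r (\<lambda>k. a k \<star> f k) x"
proof (rule ccontr)
  assume "\<not> ?thesis"
  then have *: "inf_conv r (\<lambda>k. a k \<star> f k) x < ereal (\<Sum>k<r. a k * c k)" by simp
  have "f k x \<noteq> - \<infinity>" if "k < r" for k x using bdd[OF that, of x] by auto
  from inf_conv_epi_mult_lessE[OF a this dom *] obtain z \<rho> where
    z: "\<And>k. k < r \<Longrightarrow> f k (z k) < ereal (\<rho> k)" "(\<Sum>k<r. a k * \<rho> k) < (\<Sum>k<r. a k * c k)" by metis
  have "(\<Sum>k<r. a k * c k) \<le> (\<Sum>k<r. a k * \<rho> k)"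
  proof (intro sum_mono mult_left_mono)
    fix k assume "k \<in> {..<r}"
    then have "ereal (c k) < ereal (\<rho> k)" using bdd z(1) by (meson lessThan_iff le_less_trans)
    then show "c k \<le> \<rho> k" by simp
  qed (use a in auto)
  with z(2) show False by simp
qed

lemma inf_conv_epi_mult_domain:
  assumes a: "\<And>k. k < r \<Longrightarrow> a k \<ge> 0"
    and proper: "\<And>k x. k < r \<Longrightarrow> f k x \<noteq> - \<infinity>" "\<And>k. k < r \<Longrightarrow> \<exists>x. f k x \<noteq> \<infinity>"
  shows "\<exists>x. inf_conv r (\<lambda>k. a k \<star> f k) x \<noteq> \<infinity>"
proof -
  have "\<exists>x \<rho>. f k x \<le> ereal \<rho>" if "k < r" for k
    using proper[OF that] by (metis ereal_cases order_refl)
  then obtain z \<rho> where "\<And>k. k < r \<Longrightarrow> f k (z k) \<le> ereal (\<rho> k)" by metis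
  then have "inf_conv r (\<lambda>k. a k \<star> f k) (\<Sum>k<r. a k *\<^sub>R z k) \<le> ereal (\<Sum>k<r. a k * \<rho> k)"
    using a by (intro inf_conv_epi_mult_le) auto
  then have "inf_conv r (\<lambda>k. a k \<star> f k) (\<Sum>k<r. a k *\<^sub>R z k) \<noteq> \<infinity>" by auto
  then show ?thesis ..
qed

text \<open>Jensen's inequality for weights that need not have total \<open>1\<close>. If all weights vanish, the
  equations say nothing about \<open>Z\<close> and \<open>R\<close>, and any point of the epigraph will do.\<close>
lemma epigraph_weighted_mean:
  fixes r :: nat
  assumes conv: "ereal_convex f" and w: "\<And>i. i < r \<Longrightarrow> w i \<ge> 0"
    and epi: "\<And>i. i < r \<Longrightarrow> f (z i) \<le> ereal (\<rho> i)" and dom: "\<exists>x \<rho>. f x \<le> ereal \<rho>"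
  obtains Z R where "f Z \<le> ereal R" "(\<Sum>i<r. w i) *\<^sub>R Z = (\<Sum>i<r. w i *\<^sub>R z i)"
    "(\<Sum>i<r. w i) * R = (\<Sum>i<r. w i * \<rho> i)"
proof (cases "(\<Sum>i<r. w i) = 0")
  case True
  have "\<forall>i\<in>{..<r}. w i = 0"
    using True w sum_nonneg_eq_0_iff[of "{..<r}" w] by auto
  then have "w i = 0" if "i < r" for i using that by auto
  then show ?thesis using dom True that by auto
next
  case False
  define W where "W = (\<Sum>i<r. w i)"
  have W: "W > 0" using False w sum_nonneg[of "{..<r}" w] by (auto simp: W_def less_le)
  have "(\<Sum>i<r. (w i / W) *\<^sub>R (z i, \<rho> i)) \<in> {(x, r). f x \<le> ereal r}"
    using w W epi by (intro convex_sum ereal_convex_imp_convex_epigraph conv)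
      (auto simp: W_def sum_divide_distrib[symmetric])
  then have "f (\<Sum>i<r. (w i / W) *\<^sub>R z i) \<le> ereal (\<Sum>i<r. (w i / W) * \<rho> i)"
    by (simp add: case_prod_unfold fst_sum snd_sum)
  then show ?thesis
    using that W by (auto simp: W_def[symmetric] scaleR_sum_right sum_distrib_left)
qed

text \<open>For \<open>\<le>\<close>, one choice of points \<open>z k\<close> for the weights on the right can be used in all inner
  convolutions on the left. For \<open>\<ge>\<close>, each inner convolution has its own points \<open>z i k\<close>, and
  convexity allows replacing them by their mean over \<open>i\<close> with weights \<open>\<alpha> i * b i k\<close>. The lower bounds
  \<open>c\<close> guarantee that the inner convolutions do not attain \<open>- \<infinity>\<close>.\<close>
lemma inf_conv_epi_mult_compose:
  assumes \<alpha>: "\<And>i. i < s \<Longrightarrow> \<alpha> i \<ge> 0" and b: "\<And>i k. i < s \<Longrightarrow> k < r \<Longrightarrow> b i k \<ge> 0"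
    and conv: "\<And>k. k < r \<Longrightarrow> ereal_convex (f k)"
    and bdd: "\<And>k x. k < r \<Longrightarrow> ereal (c k) \<le> f k x" and dom: "\<And>k. k < r \<Longrightarrow> \<exists>x. f k x \<noteq> \<infinity>"
  shows "inf_conv s (\<lambda>i. \<alpha> i \<star> inf_conv r (\<lambda>k. b i k \<star> f k))
       = inf_conv r (\<lambda>k. (\<Sum>i<s. \<alpha> i * b i k) \<star> f k)"
proof
  fix x
  define h where "h i = inf_conv r (\<lambda>k. b i k \<star> f k)" for i
  define A where "A k = (\<Sum>i<s. \<alpha> i * b i k)" for k
  have A: "A k \<ge> 0" if "k < r" for k
    unfolding A_def using \<alpha> b that by (intro sum_nonneg) auto
  have f_ninf: "f k x \<noteq> - \<infinity>" if "k < r" for k x using bdd[OF that, of x] by auto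
  have h_ninf: "h i x \<noteq> - \<infinity>" if "i < s" for i x
    using inf_conv_epi_mult_ge[of r "b i" c f x] b bdd dom that by (auto simp: h_def)
  have h_dom: "\<exists>x. h i x \<noteq> \<infinity>" if "i < s" for i
    unfolding h_def using b[OF that] f_ninf dom by (rule inf_conv_epi_mult_domain)
  have f_dom: "\<exists>x \<rho>. f k x \<le> ereal \<rho>" if "k < r" for k
    using f_ninf[OF that] dom[OF that] by (metis ereal_cases order_refl)
  have "inf_conv s (\<lambda>i. \<alpha> i \<star> h i) x \<le> inf_conv r (\<lambda>k. A k \<star> f k) x"
  proof (rule ereal_le_if_le_greater_reals)
    fix t assume "inf_conv r (\<lambda>k. A k \<star> f k) x < ereal t"
    from inf_conv_epi_mult_lessE[OF A f_ninf dom this] obtain z \<rho> where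
      z: "(\<Sum>k<r. A k *\<^sub>R z k) = x" "\<And>k. k < r \<Longrightarrow> f k (z k) < ereal (\<rho> k)" "(\<Sum>k<r. A k * \<rho> k) < t"
      by metis
    have "h i (\<Sum>k<r. b i k *\<^sub>R z k) \<le> ereal (\<Sum>k<r. b i k * \<rho> k)" if "i < s" for i
      unfolding h_def using b that z(2) by (intro inf_conv_epi_mult_le) (auto intro: less_imp_le)
    moreover have "(\<Sum>i<s. \<alpha> i *\<^sub>R (\<Sum>k<r. b i k *\<^sub>R z k)) = x"
      unfolding z(1)[symmetric] A_def scaleR_sum_left scaleR_sum_right scaleR_scaleR
      by (rule sum.swap)
    ultimately have "inf_conv s (\<lambda>i. \<alpha> i \<star> h i) x \<le> ereal (\<Sum>i<s. \<alpha> i * (\<Sum>k<r. b i k * \<rho> k))"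
      by (intro inf_conv_epi_mult_le) (auto intro: \<alpha>)
    also have "(\<Sum>i<s. \<alpha> i * (\<Sum>k<r. b i k * \<rho> k)) = (\<Sum>k<r. A k * \<rho> k)"
      unfolding A_def sum_distrib_left sum_distrib_right mult.assoc by (rule sum.swap)
    finally show "inf_conv s (\<lambda>i. \<alpha> i \<star> h i) x \<le> ereal t"
      using z(3) by (meson ereal_less_eq(3) less_imp_le order_trans)
  qed
  moreover have "inf_conv r (\<lambda>k. A k \<star> f k) x \<le> inf_conv s (\<lambda>i. \<alpha> i \<star> h i) x"
  proof (rule ereal_le_if_le_greater_reals)
    fix t assume "inf_conv s (\<lambda>i. \<alpha> i \<star> h i) x < ereal t"
    from inf_conv_epi_mult_lessE[OF \<alpha> h_ninf h_dom this] obtain y \<sigma> where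
      y: "(\<Sum>i<s. \<alpha> i *\<^sub>R y i) = x" "\<And>i. i < s \<Longrightarrow> h i (y i) < ereal (\<sigma> i)" "(\<Sum>i<s. \<alpha> i * \<sigma> i) < t"
      by metis
    define Q where "Q i z \<rho> \<longleftrightarrow> (\<Sum>k<r. b i k *\<^sub>R z k) = y i \<and> (\<forall>k<r. f k (z k) < ereal (\<rho> k))
        \<and> (\<Sum>k<r. b i k * \<rho> k) < \<sigma> i" for i z \<rho>
    have "\<exists>z \<rho>. Q i z \<rho>" if "i < s" for i
      by (rule inf_conv_epi_mult_lessE[OF b[OF that] f_ninf dom y(2)[OF that, unfolded h_def]])
        (auto simp: Q_def)
    then obtain z \<rho> where "\<And>i. i < s \<Longrightarrow> Q i (z i) (\<rho> i)" by metis
    then have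
      z: "\<And>i. i < s \<Longrightarrow> (\<Sum>k<r. b i k *\<^sub>R z i k) = y i"
        "\<And>i k. i < s \<Longrightarrow> k < r \<Longrightarrow> f k (z i k) < ereal (\<rho> i k)"
        "\<And>i. i < s \<Longrightarrow> (\<Sum>k<r. b i k * \<rho> i k) < \<sigma> i"
      unfolding Q_def by blast+
    define P where "P k Z R \<longleftrightarrow> f k Z \<le> ereal R \<and> A k *\<^sub>R Z = (\<Sum>i<s. (\<alpha> i * b i k) *\<^sub>R z i k)
        \<and> A k * R = (\<Sum>i<s. \<alpha> i * b i k * \<rho> i k)" for k Z R
    have "\<exists>Z R. P k Z R" if "k < r" for k
      unfolding P_def A_def
      by (rule epigraph_weighted_mean[OF conv[OF that], of s "\<lambda>i. \<alpha> i * b i k" "\<lambda>i. z i k" "\<lambda>i. \<rho> i k"])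
        (use that \<alpha> b z(2) f_dom in \<open>auto intro: less_imp_le\<close>)
    then obtain Z R where "\<And>k. k < r \<Longrightarrow> P k (Z k) (R k)" by metis
    then have ZR: "\<And>k. k < r \<Longrightarrow> f k (Z k) \<le> ereal (R k)"
      "\<And>k. k < r \<Longrightarrow> A k *\<^sub>R Z k = (\<Sum>i<s. (\<alpha> i * b i k) *\<^sub>R z i k)"
      "\<And>k. k < r \<Longrightarrow> A k * R k = (\<Sum>i<s. \<alpha> i * b i k * \<rho> i k)"
      unfolding P_def by blast+
    have "(\<Sum>k<r. A k *\<^sub>R Z k) = (\<Sum>k<r. \<Sum>i<s. (\<alpha> i * b i k) *\<^sub>R z i k)"
      using ZR(2) by simp
    also have "\<dots> = (\<Sum>i<s. \<alpha> i *\<^sub>R (\<Sum>k<r. b i k *\<^sub>R z i k))"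
      unfolding scaleR_sum_right scaleR_scaleR by (rule sum.swap)
    also have "\<dots> = x" using z(1) y(1) by simp
    finally have "inf_conv r (\<lambda>k. A k \<star> f k) x \<le> ereal (\<Sum>k<r. A k * R k)"
      using A ZR(1) by (intro inf_conv_epi_mult_le)
    also have "(\<Sum>k<r. A k * R k) = (\<Sum>k<r. \<Sum>i<s. \<alpha> i * b i k * \<rho> i k)"
      using ZR(3) by simp
    also have "\<dots> = (\<Sum>i<s. \<alpha> i * (\<Sum>k<r. b i k * \<rho> i k))"
      unfolding sum_distrib_left mult.assoc by (rule sum.swap)
    also have "\<dots> \<le> (\<Sum>i<s. \<alpha> i * \<sigma> i)"
      using \<alpha> z(3) by (intro sum_mono mult_left_mono) (auto intro: less_imp_le)
    also have "\<dots> \<le> t" using y(3) by simp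
    finally show "inf_conv r (\<lambda>k. A k \<star> f k) x \<le> ereal t" by simp
  qed
  ultimately show "inf_conv s (\<lambda>i. \<alpha> i \<star> inf_conv r (\<lambda>k. b i k \<star> f k)) x
       = inf_conv r (\<lambda>k. (\<Sum>i<s. \<alpha> i * b i k) \<star> f k) x"
    unfolding h_def A_def by (rule antisym)
qed

lemma inf_conv_unit_weights:
  assumes "j < r"
  shows "inf_conv r (\<lambda>k. (if j = k then 1 else 0) \<star> f k) = f j"
proof
  fix x
  have one: "1 \<star> h = h" for h :: "'a \<Rightarrow> ereal" by (simp add: epi_mult_def one_ereal_def[symmetric])
  have zero: "0 \<star> h = indicator_zero" for h :: "'a \<Rightarrow> ereal" by (simp add: epi_mult_def)
  have split: "(\<Sum>k<r. F k) = F j + (\<Sum>k\<in>{..<r} - {j}. F k)" for F :: "nat \<Rightarrow> 'b::comm_monoid_add"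
    using assms by (simp add: sum.remove)
  have val: "(\<Sum>k<r. ((if j = k then 1 else 0) \<star> f k) (y k))
      = f j (y j) + (\<Sum>k\<in>{..<r} - {j}. indicator_zero (y k))" for y
    by (subst split) (auto simp: one zero intro!: arg_cong2[where f = "(+)"] sum.cong)
  show "inf_conv r (\<lambda>k. (if j = k then 1 else 0) \<star> f k) x = f j x"
    unfolding inf_conv_def
  proof (rule antisym)
    show "Inf {\<Sum>k<r. ((if j = k then 1 else 0) \<star> f k) (y k) |y. sum y {..<r} = x} \<le> f j x"
    proof (rule Inf_lower, rule CollectI, intro exI conjI)
      show "(\<Sum>k<r. if k = j then x else 0) = x" using assms by simp
      show "f j x = (\<Sum>k<r. ((if j = k then 1 else 0) \<star> f k) (if k = j then x else 0))"
        unfolding val by (simp add: indicator_zero_def)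
    qed
    show "f j x \<le> Inf {\<Sum>k<r. ((if j = k then 1 else 0) \<star> f k) (y k) |y. sum y {..<r} = x}"
    proof (rule Inf_greatest, safe)
      fix y :: "nat \<Rightarrow> 'a"
      show "f j (sum y {..<r}) \<le> (\<Sum>k<r. ((if j = k then 1 else 0) \<star> f k) (y k))"
      proof (cases "\<forall>k\<in>{..<r} - {j}. y k = 0")
        case True
        then have "sum y {..<r} = y j" by (subst split) simp
        with True show ?thesis unfolding val by (simp add: indicator_zero_def)
      next
        case False
        then have "(\<Sum>k\<in>{..<r} - {j}. indicator_zero (y k)) = \<infinity>"
          by (subst sum_Pinfty) (auto simp: indicator_zero_def)
        then show ?thesis unfolding val by simp
      qed
    qed
  qed
qed

section \<open>Epi-convergence for convergent weights\<close>

definition supercoercive :: "('a::real_normed_vector \<Rightarrow> ereal) \<Rightarrow> bool" where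
  "supercoercive f \<longleftrightarrow> (\<forall>M. \<exists>C. \<forall>x. ereal (M * norm x - C) \<le> f x)"

lemma supercoercive_bounded_below:
  assumes "supercoercive f"
  shows "\<exists>c. \<forall>x. ereal c \<le> f x"
proof -
  obtain C where "\<forall>x. ereal (0 * norm x - C) \<le> f x" using assms unfolding supercoercive_def by blast
  then show ?thesis by (intro exI[of _ "- C"]) simp
qed

text \<open>By Young's inequality, \<open>f x \<ge> x \<bullet> v - c\<close>, where \<open>c\<close> is the finite value of the conjugate at
  \<open>v\<close>. Finitely many \<open>v\<close> suffice for a norm bound, namely large multiples of \<open>\<plusminus> b\<close> for \<open>b\<close> in the
  standard basis. The resulting bounds are averaged over \<open>b\<close>.\<close>
lemma cofinite_fun_imp_supercoercive:
  fixes f :: "'a::euclidean_space \<Rightarrow> ereal"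
  assumes cof: "cofinite_fun f" and ninf: "\<And>x. f x \<noteq> - \<infinity>"
  shows "supercoercive f"
  unfolding supercoercive_def
proof
  fix M :: real
  define D where "D = real DIM('a)"
  have D: "D > 0" by (simp add: D_def)
  define F where "F v = real_of_ereal (fenchel_conj f v)" for v
  have young: "x \<bullet> v - r \<le> F v" if "f x = ereal r" for x v r
  proof -
    have "ereal (v \<bullet> x) - f x \<le> fenchel_conj f v"
      unfolding fenchel_conj_def by (rule SUP_upper) simp
    also have "\<dots> = ereal (F v)" using cof by (simp add: F_def cofinite_fun_def ereal_real)
    finally show ?thesis using that by (simp add: inner_commute)
  qed
  \<comment> \<open>The factor \<open>D\<close> makes up for the division by the number of basis vectors in the average.\<close>
  define N where "N = \<bar>M\<bar> * D"
  define c where "c b = max (F (N *\<^sub>R b)) (F (- N *\<^sub>R b))" for b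
  show "\<exists>C. \<forall>x. ereal (M * norm x - C) \<le> f x"
  proof (intro exI allI)
    fix x
    show "ereal (M * norm x - (\<Sum>b\<in>Basis. c b) / D) \<le> f x"
    proof (cases "f x")
      case (real r)
      have b: "N * \<bar>x \<bullet> b\<bar> \<le> r + c b" for b
        using young[OF real, of "N *\<^sub>R b"] young[OF real, of "- N *\<^sub>R b"]
        by (auto simp: c_def abs_if)
      have "N * norm x \<le> N * (\<Sum>b\<in>Basis. \<bar>x \<bullet> b\<bar>)"
        using D norm_le_l1[of x] by (intro mult_left_mono) (auto simp: N_def)
      also have "\<dots> \<le> (\<Sum>b\<in>Basis. r + c b)"
        unfolding sum_distrib_left by (intro sum_mono b)
      also have "\<dots> = D * r + (\<Sum>b\<in>Basis. c b)" by (simp add: sum.distrib D_def)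
      finally have "\<bar>M\<bar> * norm x \<le> r + (\<Sum>b\<in>Basis. c b) / D"
        using D by (simp add: N_def field_simps)
      moreover have "M * norm x \<le> \<bar>M\<bar> * norm x" by (intro mult_right_mono) auto
      ultimately show ?thesis using real by simp
    qed (use ninf in auto)
  qed
qed

lemma supercoercive_scaled_epigraph:
  assumes "supercoercive f"
  obtains C where "\<And>a z r. a \<ge> 0 \<Longrightarrow> f z \<le> ereal r \<Longrightarrow> M * norm (a *\<^sub>R z) - a * C \<le> a * r"
proof -
  obtain C where C: "\<And>x. ereal (M * norm x - C) \<le> f x" using assms by (auto simp: supercoercive_def)
  show ?thesis
  proof (rule that)
    fix a r :: real and z assume a: "a \<ge> 0" and "f z \<le> ereal r"
    then have "ereal (M * norm z - C) \<le> ereal r" using C by (meson order_trans)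
    then have "a * (M * norm z - C) \<le> a * r" using a by (intro mult_left_mono) auto
    then show "M * norm (a *\<^sub>R z) - a * C \<le> a * r" using a by (simp add: algebra_simps)
  qed
qed

text \<open>In effect, the set of all \<open>(l, y, s)\<close> with \<open>l \<ge> 0\<close> and \<open>(l \<star> f) y \<le> s\<close> is closed.
  At \<open>l > 0\<close> this is lower semicontinuity of \<open>f\<close>. At \<open>l = 0\<close> it needs supercoercivity: the bound \<open>M * norm (a n *\<^sub>R z n) - a n * C \<le> a n * \<rho> n\<close> becomes
  \<open>M * norm y \<le> s\<close> in the limit, for every \<open>M\<close>, which leaves only \<open>y = 0\<close> and \<open>s \<ge> 0\<close>.\<close>
lemma scaled_epigraph_limit:
  fixes f :: "'a::real_normed_vector \<Rightarrow> ereal"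
  assumes f: "f \<in> Gamma_set" "supercoercive f"
    and a: "\<And>n. a n \<ge> 0" "a \<longlonglongrightarrow> l" and epi: "\<And>n. f (z n) \<le> ereal (\<rho> n)"
    and y: "(\<lambda>n. a n *\<^sub>R z n) \<longlonglongrightarrow> y" and s: "(\<lambda>n. a n * \<rho> n) \<longlonglongrightarrow> s"
  obtains Z R where "f Z \<le> ereal R" "l *\<^sub>R Z = y" "l * R \<le> s"
proof (cases "l = 0")
  case True
  have bound: "M * norm y \<le> s" for M
  proof -
    obtain C where C: "\<And>a z r. a \<ge> 0 \<Longrightarrow> f z \<le> ereal r \<Longrightarrow> M * norm (a *\<^sub>R z) - a * C \<le> a * r"
      using supercoercive_scaled_epigraph[OF f(2)] by blast
    have "(\<lambda>n. M * norm (a n *\<^sub>R z n) - a n * C) \<longlonglongrightarrow> M * norm y - l * C"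
      by (intro tendsto_intros y a)
    then have "M * norm y - l * C \<le> s"
      by (rule LIMSEQ_le[OF _ s]) (use C a epi in blast)
    with True show ?thesis by simp
  qed
  have "y = 0"
    using bound[of "(s + 1) / norm y"] by (cases "y = 0") auto
  moreover have "s \<ge> 0" using bound[of 0] by simp
  moreover obtain Z R where "f Z \<le> ereal R" using epi by blast
  ultimately show ?thesis using that True by simp
next
  case False
  moreover have "l \<ge> 0" using a by (intro LIMSEQ_le_const[OF a(2)]) auto
  ultimately have l: "l > 0" by simp
  then have pos: "\<forall>\<^sub>F n in sequentially. a n > 0" using a(2) by (auto intro: order_tendstoD)
  have "f (inverse l *\<^sub>R y) \<le> ereal (inverse l * s)"
  proof (rule Gamma_set_sequentially_closed_epigraph[OF f(1)])
    show "(\<lambda>n. inverse (a n) *\<^sub>R (a n *\<^sub>R z n)) \<longlonglongrightarrow> inverse l *\<^sub>R y"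
      using l by (intro tendsto_intros a y) auto
    show "(\<lambda>n. inverse (a n) * (a n * \<rho> n)) \<longlonglongrightarrow> inverse l * s"
      using l by (intro tendsto_intros a s) auto
    show "\<forall>\<^sub>F n in sequentially. f (inverse (a n) *\<^sub>R (a n *\<^sub>R z n)) \<le> ereal (inverse (a n) * (a n * \<rho> n))"
      using pos
    proof eventually_elim
      case (elim n)
      then have "inverse (a n) *\<^sub>R (a n *\<^sub>R z n) = z n" "inverse (a n) * (a n * \<rho> n) = \<rho> n" by auto
      then show ?case using epi by (simp only:)
    qed
  qed
  then show ?thesis using that[of "inverse l *\<^sub>R y" "inverse l * s"] l by (simp add: mult.assoc[symmetric])
qed

lemma bounded_family_convergent_subsequence:
  fixes w :: "nat \<Rightarrow> nat \<Rightarrow> 'a::heine_borel"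
  assumes "\<And>k. k < r \<Longrightarrow> bounded (range (\<lambda>n. w n k))"
  obtains \<phi> :: "nat \<Rightarrow> nat" and l where "strict_mono \<phi>" "\<And>k. k < r \<Longrightarrow> (\<lambda>n. w (\<phi> n) k) \<longlonglongrightarrow> l k"
proof -
  have "\<forall>d\<subseteq>{..<r}. \<exists>l. \<exists>\<phi>::nat \<Rightarrow> nat. strict_mono \<phi> \<and>
    (\<forall>e>0. \<forall>\<^sub>F n in sequentially. \<forall>i\<in>d. dist (w (\<phi> n) i) (l i) < e)"
    by (rule compact_lemma_general[where unproj = "\<lambda>x. x"])
      (use assms in \<open>auto simp: image_image\<close>)
  then obtain l and \<phi> :: "nat \<Rightarrow> nat" where \<phi>: "strict_mono \<phi>"
    "\<And>e. e > 0 \<Longrightarrow> \<forall>\<^sub>F n in sequentially. \<forall>i\<in>{..<r}. dist (w (\<phi> n) i) (l i) < e" by blast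
  have "(\<lambda>n. w (\<phi> n) k) \<longlonglongrightarrow> l k" if "k < r" for k
  proof (rule tendstoI)
    fix e :: real assume "e > 0"
    from \<phi>(2)[OF this] show "\<forall>\<^sub>F n in sequentially. dist (w (\<phi> n) k) (l k) < e"
      by eventually_elim (use that in auto)
  qed
  with \<phi>(1) that show ?thesis by blast
qed

text \<open>The compactness argument behind both halves of epi-convergence. Supercoercivity bounds every
  scaled height \<open>a n k * \<rho> n k\<close> from below, up to a constant, by the norm of the scaled point. As
  the sum of the heights is bounded above, all heights and all points stay bounded, so
  a common subsequence converges for all \<open>k < r\<close>.\<close>
lemma weighted_epigraph_sums_limit:
  fixes f :: "nat \<Rightarrow> 'a::euclidean_space \<Rightarrow> ereal"
  assumes f: "\<And>k. k < r \<Longrightarrow> f k \<in> Gamma_set" "\<And>k. k < r \<Longrightarrow> supercoercive (f k)"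
    and a: "\<And>n k. k < r \<Longrightarrow> a n k \<ge> 0" "\<And>k. k < r \<Longrightarrow> (\<lambda>n. a n k) \<longlonglongrightarrow> l k"
    and epi: "\<And>n k. k < r \<Longrightarrow> f k (z n k) \<le> ereal (\<rho> n k)"
    and x: "(\<lambda>n. \<Sum>k<r. a n k *\<^sub>R z n k) \<longlonglongrightarrow> x"
    and c: "\<And>n. (\<Sum>k<r. a n k * \<rho> n k) \<le> c n" "c \<longlonglongrightarrow> c'"
  obtains Z R where "\<And>k. k < r \<Longrightarrow> f k (Z k) \<le> ereal (R k)"
    "(\<Sum>k<r. l k *\<^sub>R Z k) = x" "(\<Sum>k<r. l k * R k) \<le> c'"
proof -
  define w where "w n k = (a n k *\<^sub>R z n k, a n k * \<rho> n k)" for n k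
  have "\<exists>B. \<forall>n. norm (a n k *\<^sub>R z n k) \<le> a n k * \<rho> n k + B" if k: "k < r" for k
  proof -
    obtain C where C: "\<And>a z r. a \<ge> 0 \<Longrightarrow> f k z \<le> ereal r \<Longrightarrow> 1 * norm (a *\<^sub>R z) - a * C \<le> a * r"
      using supercoercive_scaled_epigraph[OF f(2)[OF k]] by blast
    have "Bseq (\<lambda>n. a n k)" using a(2)[OF k] by (intro convergent_imp_Bseq) (auto simp: convergent_def)
    then obtain A where A: "\<And>n. \<bar>a n k\<bar> \<le> A" by (auto simp: Bseq_def)
    have "norm (a n k *\<^sub>R z n k) \<le> a n k * \<rho> n k + A * \<bar>C\<bar>" for n
    proof -
      have "a n k * C \<le> a n k * \<bar>C\<bar>" using a(1)[OF k, of n] by (intro mult_left_mono) auto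
      also have "\<dots> \<le> A * \<bar>C\<bar>" using A[of n] by (intro mult_right_mono) auto
      finally have "a n k * C \<le> A * \<bar>C\<bar>" .
      then show ?thesis using C[OF a(1)[OF k] epi[OF k], of n n] by linarith
    qed
    then show ?thesis by blast
  qed
  then obtain B where B: "\<And>n k. k < r \<Longrightarrow> norm (a n k *\<^sub>R z n k) \<le> a n k * \<rho> n k + B k" by metis
  then have B': "0 \<le> a n k * \<rho> n k + B k" if "k < r" for n k
    using that by (meson norm_ge_zero order_trans)
  have "Bseq c" using c(2) by (intro convergent_imp_Bseq) (auto simp: convergent_def)
  then obtain c0 where c0: "\<And>n. \<bar>c n\<bar> \<le> c0" by (auto simp: Bseq_def)
  define E where "E = c0 + (\<Sum>k<r. B k)"
  have up: "a n k * \<rho> n k + B k \<le> E" if k: "k < r" for n k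
  proof -
    have "a n k * \<rho> n k + B k \<le> (\<Sum>k<r. a n k * \<rho> n k + B k)"
      using k B' by (intro member_le_sum) auto
    also have "\<dots> \<le> E" using c(1)[of n] c0[of n] by (simp add: sum.distrib E_def)
    finally show ?thesis .
  qed
  have "bounded (range (\<lambda>n. w n k))" if k: "k < r" for k
  proof (rule bounded_subset)
    show "bounded (cball (0::'a) E \<times> {- B k..E - B k})" by (intro bounded_Times) auto
    have "w n k \<in> cball 0 E \<times> {- B k..E - B k}" for n
      using B[OF k, of n] B'[OF k, of n] up[OF k, of n] unfolding w_def by (auto simp del: norm_scaleR)
    then show "range (\<lambda>n. w n k) \<subseteq> cball 0 E \<times> {- B k..E - B k}" by blast
  qed
  then obtain \<phi> :: "nat \<Rightarrow> nat" and lim where \<phi>: "strict_mono \<phi>"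
    and lim: "\<And>k. k < r \<Longrightarrow> (\<lambda>n. w (\<phi> n) k) \<longlonglongrightarrow> lim k"
    using bounded_family_convergent_subsequence[of r w] by blast
  have y: "(\<lambda>n. a (\<phi> n) k *\<^sub>R z (\<phi> n) k) \<longlonglongrightarrow> fst (lim k)" if "k < r" for k
    using tendsto_fst[OF lim[OF that]] by (simp add: w_def)
  have s: "(\<lambda>n. a (\<phi> n) k * \<rho> (\<phi> n) k) \<longlonglongrightarrow> snd (lim k)" if "k < r" for k
    using tendsto_snd[OF lim[OF that]] by (simp add: w_def)
  have "\<exists>Z R. f k Z \<le> ereal R \<and> l k *\<^sub>R Z = fst (lim k) \<and> l k * R \<le> snd (lim k)" if k: "k < r" for k
    using scaled_epigraph_limit[OF f[OF k] a(1)[OF k]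
        LIMSEQ_subseq_LIMSEQ[OF a(2)[OF k] \<phi>, unfolded o_def] epi[OF k] y[OF k] s[OF k]]
    by metis
  then obtain Z R where ZR: "\<And>k. k < r \<Longrightarrow> f k (Z k) \<le> ereal (R k)"
    "\<And>k. k < r \<Longrightarrow> l k *\<^sub>R Z k = fst (lim k)" "\<And>k. k < r \<Longrightarrow> l k * R k \<le> snd (lim k)" by metis
  show ?thesis
  proof (rule that[OF ZR(1)])
    have "(\<lambda>n. \<Sum>k<r. a (\<phi> n) k *\<^sub>R z (\<phi> n) k) \<longlonglongrightarrow> (\<Sum>k<r. fst (lim k))"
      by (intro tendsto_sum y) auto
    then have "(\<Sum>k<r. fst (lim k)) = x"
      using LIMSEQ_subseq_LIMSEQ[OF x \<phi>] by (auto simp: o_def intro: LIMSEQ_unique)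
    then show "(\<Sum>k<r. l k *\<^sub>R Z k) = x" using ZR(2) by simp
    have "(\<lambda>n. \<Sum>k<r. a (\<phi> n) k * \<rho> (\<phi> n) k) \<longlonglongrightarrow> (\<Sum>k<r. snd (lim k))"
      by (intro tendsto_sum s) auto
    then have "(\<Sum>k<r. snd (lim k)) \<le> c'"
      using LIMSEQ_subseq_LIMSEQ[OF c(2) \<phi>] c(1) by (auto simp: o_def intro!: LIMSEQ_le)
    then show "(\<Sum>k<r. l k * R k) \<le> c'"
      using sum_mono[of "{..<r}" "\<lambda>k. l k * R k" "\<lambda>k. snd (lim k)"] ZR(3) by fastforce
  qed
qed

text \<open>The lower bound is the compactness lemma, applied along a subsequence to decompositions whose
  value stays below a real number strictly between the lower limit and the value to be bounded; the recovery sequence reuses an optimal decomposition for the limit weights.\<close>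
lemma epi_converges_inf_conv_epi_mult:
  fixes f :: "nat \<Rightarrow> 'a::euclidean_space \<Rightarrow> ereal"
  assumes f: "\<And>k. k < r \<Longrightarrow> f k \<in> Gamma_set" "\<And>k. k < r \<Longrightarrow> supercoercive (f k)"
    and a: "\<And>n k. k < r \<Longrightarrow> a n k \<ge> 0" "\<And>k. k < r \<Longrightarrow> (\<lambda>n. a n k) \<longlonglongrightarrow> l k"
  shows "epi_converges (\<lambda>n. inf_conv r (\<lambda>k. a n k \<star> f k)) (inf_conv r (\<lambda>k. l k \<star> f k))"
proof -
  define h where "h b = inf_conv r (\<lambda>k. b k \<star> f k)" for b
  have l: "l k \<ge> 0" if "k < r" for k
    using a(1)[OF that] by (intro LIMSEQ_le_const[OF a(2)[OF that]]) auto
  have proper: "f k x \<noteq> - \<infinity>" "\<exists>x. f k x \<noteq> \<infinity>" if "k < r" for k x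
    using f(1)[OF that] by (auto simp: Gamma_set_def)
  have "\<exists>c. \<forall>x. ereal c \<le> f k x" if "k < r" for k
    using f(2)[OF that] by (rule supercoercive_bounded_below)
  then obtain c where c: "\<And>k x. k < r \<Longrightarrow> ereal (c k) \<le> f k x" by metis
  have ninf: "h b x \<noteq> - \<infinity>" if "\<And>k. k < r \<Longrightarrow> b k \<ge> 0" for b x
    using inf_conv_epi_mult_ge[of r b c f x] that c proper by (auto simp: h_def)
  define Q where "Q b x t z \<rho> \<longleftrightarrow> (\<Sum>k<r. b k *\<^sub>R z k) = x \<and> (\<forall>k<r. f k (z k) \<le> ereal (\<rho> k))
      \<and> (\<Sum>k<r. b k * \<rho> k) \<le> t" for b x t z \<rho>
  have lessE: "\<exists>z \<rho>. Q b x t z \<rho>"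
    if b: "\<And>k. k < r \<Longrightarrow> b k \<ge> 0" and less: "h b x < ereal t" for b x t
  proof -
    obtain z \<rho> where "(\<Sum>k<r. b k *\<^sub>R z k) = x" "\<And>k. k < r \<Longrightarrow> f k (z k) < ereal (\<rho> k)"
      "(\<Sum>k<r. b k * \<rho> k) < t"
      by (rule inf_conv_epi_mult_lessE[OF b proper less[unfolded h_def]]) auto
    then show ?thesis unfolding Q_def by (intro exI[of _ z] exI[of _ \<rho>]) (auto intro: less_imp_le)
  qed
  have liminf: "h l x \<le> liminf (\<lambda>n. h (a n) (xs n))" if xs: "xs \<longlonglongrightarrow> x" for x xs
  proof (rule ccontr)
    assume "\<not> ?thesis"
    then obtain t where t: "liminf (\<lambda>n. h (a n) (xs n)) < ereal t" "ereal t < h l x"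
      using ereal_dense2[of _ "h l x"] by (meson not_le)
    have "\<not> (\<forall>\<^sub>F n in sequentially. ereal t \<le> h (a n) (xs n))"
      using t(1) Liminf_bounded[of "ereal t" "\<lambda>n. h (a n) (xs n)" sequentially] by auto
    then obtain \<phi> :: "nat \<Rightarrow> nat" where \<phi>: "strict_mono \<phi>" "\<And>n. h (a (\<phi> n)) (xs (\<phi> n)) < ereal t"
      using not_eventually_sequentiallyD[of "\<lambda>n. ereal t \<le> h (a n) (xs n)"] by (auto simp: not_le)
    have "\<exists>z \<rho>. Q (a (\<phi> n)) (xs (\<phi> n)) t z \<rho>" for n
      by (rule lessE[OF a(1) \<phi>(2)])
    then obtain z \<rho> where "\<And>n. Q (a (\<phi> n)) (xs (\<phi> n)) t (z n) (\<rho> n)" by metis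
    then have z: "\<And>n. (\<Sum>k<r. a (\<phi> n) k *\<^sub>R z n k) = xs (\<phi> n)"
      "\<And>n k. k < r \<Longrightarrow> f k (z n k) \<le> ereal (\<rho> n k)" "\<And>n. (\<Sum>k<r. a (\<phi> n) k * \<rho> n k) \<le> t"
      unfolding Q_def by blast+
    obtain Z R where "\<And>k. k < r \<Longrightarrow> f k (Z k) \<le> ereal (R k)"
      "(\<Sum>k<r. l k *\<^sub>R Z k) = x" "(\<Sum>k<r. l k * R k) \<le> t"
    proof (rule weighted_epigraph_sums_limit[OF f, where a = "\<lambda>n. a (\<phi> n)" and z = z and \<rho> = \<rho> and c = "\<lambda>_. t"])
      show "(\<lambda>n. a (\<phi> n) k) \<longlonglongrightarrow> l k" if "k < r" for k
        using LIMSEQ_subseq_LIMSEQ[OF a(2)[OF that] \<phi>(1)] by (simp add: o_def)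
      show "(\<lambda>n. \<Sum>k<r. a (\<phi> n) k *\<^sub>R z n k) \<longlonglongrightarrow> x"
        using LIMSEQ_subseq_LIMSEQ[OF xs \<phi>(1)] by (simp add: o_def z(1))
    qed (use a(1) z in auto)
    then have "h l x \<le> ereal t"
      using inf_conv_epi_mult_le[of r l f Z R x] l unfolding h_def
      by (meson ereal_less_eq(3) order_trans)
    with t(2) show False by simp
  qed
  have limsup: "\<exists>ys. ys \<longlonglongrightarrow> x \<and> limsup (\<lambda>n. h (a n) (ys n)) \<le> h l x" for x
  proof (cases "h l x")
    case (real t)
    have "h l x < ereal (t + inverse (real (Suc n)))" for n using real by simp
    then have "\<exists>z \<rho>. Q l x (t + inverse (real (Suc n))) z \<rho>" for n
      by (intro lessE l)
    then obtain z \<rho> where "\<And>n. Q l x (t + inverse (real (Suc n))) (z n) (\<rho> n)" by metis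
    then have z: "\<And>n. (\<Sum>k<r. l k *\<^sub>R z n k) = x"
      "\<And>n k. k < r \<Longrightarrow> f k (z n k) \<le> ereal (\<rho> n k)"
      "\<And>n. (\<Sum>k<r. l k * \<rho> n k) \<le> t + inverse (real (Suc n))"
      unfolding Q_def by blast+
    obtain Z R where Z: "\<And>k. k < r \<Longrightarrow> f k (Z k) \<le> ereal (R k)"
      "(\<Sum>k<r. l k *\<^sub>R Z k) = x" "(\<Sum>k<r. l k * R k) \<le> t"
    proof (rule weighted_epigraph_sums_limit[OF f, where a = "\<lambda>n. l" and z = z and \<rho> = \<rho>
          and c = "\<lambda>n. t + inverse (real (Suc n))"])
      show "(\<lambda>n. t + inverse (real (Suc n))) \<longlonglongrightarrow> t"
        using LIMSEQ_inverse_real_of_nat_add by simp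
    qed (use l z in auto)
    \<comment> \<open>The points \<open>Z k\<close> attain the infimum for the weights \<open>l\<close>; only the weights are varied.\<close>
    define ys where "ys n = (\<Sum>k<r. a n k *\<^sub>R Z k)" for n
    have "ys \<longlonglongrightarrow> (\<Sum>k<r. l k *\<^sub>R Z k)" unfolding ys_def by (intro tendsto_intros a) auto
    moreover have "limsup (\<lambda>n. h (a n) (ys n)) \<le> h l x"
    proof -
      have "limsup (\<lambda>n. h (a n) (ys n)) \<le> limsup (\<lambda>n. ereal (\<Sum>k<r. a n k * R k))"
        unfolding h_def ys_def using a(1) Z(1)
        by (intro Limsup_mono always_eventually allI inf_conv_epi_mult_le) auto
      also have "\<dots> = ereal (\<Sum>k<r. l k * R k)"
        by (intro lim_imp_Limsup tendsto_intros a) auto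
      finally show ?thesis using Z(3) real by (metis ereal_less_eq(3) order_trans)
    qed
    ultimately show ?thesis using Z(2) by auto
  next
    case PInf
    then show ?thesis by (intro exI[of _ "\<lambda>_. x"]) simp
  qed (use ninf[OF l] in simp)
  show ?thesis
    unfolding epi_converges_def h_def[symmetric]
    using ninf l a(1) liminf limsup by simp
qed

section \<open>The iterates\<close>

text \<open>With this congruence rule the termination proof of the next function may use \<open>i < m\<close>
  inside the sum.\<close>
lemmas [fundef_cong] = sum.cong

text \<open>The weight of \<open>g k\<close> in \<open>g n\<close>: as a function of \<open>n\<close>, the solution of the recurrence whose first
  \<open>m\<close> values form the \<open>k\<close>-th unit vector.\<close>
function recurrence_weight :: "nat \<Rightarrow> (nat \<Rightarrow> real) \<Rightarrow> nat \<Rightarrow> nat \<Rightarrow> real" where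
  "recurrence_weight m \<alpha> n k =
     (if n < m then (if n = k then 1 else 0)
      else \<Sum>i<m. \<alpha> i * recurrence_weight m \<alpha> (n - m + i) k)"
  by pat_completeness auto
termination by (relation "Wellfounded.measure (\<lambda>(m, \<alpha>, n, k). n)") auto

declare recurrence_weight.simps [simp del]

lemma recurrence_weight_nonneg:
  assumes "\<And>i. i < m \<Longrightarrow> \<alpha> i \<ge> 0"
  shows "recurrence_weight m \<alpha> n k \<ge> 0"
proof (induction n rule: less_induct)
  case (less n)
  show ?case
    by (subst recurrence_weight.simps) (auto intro!: sum_nonneg mult_nonneg_nonneg assms less)
qed

lemma recurrence_weight_tendsto_lam:
  assumes "\<And>i. i < m \<Longrightarrow> \<alpha> i \<ge> 0" "(\<Sum>i<m. \<alpha> i) = 1" "basic_hypothesis m \<alpha>" and k: "k < m"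
  shows "(\<lambda>n. recurrence_weight m \<alpha> n k) \<longlonglongrightarrow> lam m \<alpha> k"
proof -
  let ?w = "\<lambda>n. recurrence_weight m \<alpha> n k"
  have "?w \<longlonglongrightarrow> (\<Sum>j<m. lam m \<alpha> j * ?w j)"
    by (rule recurrence_tendsto_weighted_average[OF assms(1-3)], assumption)
      (subst recurrence_weight.simps, simp add: add.commute)
  also have "(\<Sum>j<m. lam m \<alpha> j * ?w j) = (\<Sum>j<m. if j = k then lam m \<alpha> j else 0)"
    by (intro sum.cong) (auto simp: recurrence_weight.simps[of _ _ _ k])
  also have "\<dots> = lam m \<alpha> k" using k by simp
  finally show ?thesis .
qed

lemma inf_conv_cong:
  "(\<And>i. i < r \<Longrightarrow> f i = f' i) \<Longrightarrow> inf_conv r f = inf_conv r f'"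
  by (simp add: inf_conv_def fun_eq_iff)

theorem theorem6p4:
  fixes m :: nat and \<alpha> :: "nat \<Rightarrow> real" and g :: "nat \<Rightarrow> real ^ 'm \<Rightarrow> ereal"
  assumes "m = CARD('m)" and "m \<ge> 2"
    and "\<And>i. i < m \<Longrightarrow> \<alpha> i \<ge> 0" and "(\<Sum>i<m. \<alpha> i) = 1"
    and "\<And>k. k < m \<Longrightarrow> g k \<in> Gamma_set"
    and "\<And>n. n \<ge> m \<Longrightarrow> g n = inf_conv m (\<lambda>i. \<alpha> i \<star> g (n - m + i))"
    and "\<And>k. k < m \<Longrightarrow> cofinite_fun (g k)"
    and "basic_hypothesis m \<alpha>"
  shows "epi_converges g (inf_conv m (\<lambda>k. lam m \<alpha> k \<star> g k))"
proof -
  let ?w = "recurrence_weight m \<alpha>"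
  note \<alpha> = assms(3,4)
  have Gamma: "ereal_convex (g k)" "g k x \<noteq> - \<infinity>" "\<exists>x. g k x \<noteq> \<infinity>" if "k < m" for k x
    using assms(5)[OF that] by (auto simp: Gamma_set_def)
  have super: "supercoercive (g k)" if "k < m" for k
    using that assms(7) Gamma by (intro cofinite_fun_imp_supercoercive) auto
  have "\<exists>c. \<forall>x. ereal c \<le> g k x" if "k < m" for k
    using super[OF that] by (intro supercoercive_bounded_below)
  then obtain c where c: "\<And>k x. k < m \<Longrightarrow> ereal (c k) \<le> g k x" by metis
  have closed_form: "g n = inf_conv m (\<lambda>k. ?w n k \<star> g k)" for n
  proof (induction n rule: less_induct)
    case (less n)
    show ?case
    proof (cases "n < m")
      case True
      then have "inf_conv m (\<lambda>k. ?w n k \<star> g k) = inf_conv m (\<lambda>k. (if n = k then 1 else 0) \<star> g k)"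
        by (simp add: recurrence_weight.simps[of m \<alpha> n])
      also have "\<dots> = g n" by (rule inf_conv_unit_weights[OF True])
      finally show ?thesis by (rule sym)
    next
      case False
      have "g n = inf_conv m (\<lambda>i. \<alpha> i \<star> g (n - m + i))" using False assms(6) by simp
      also have "\<dots> = inf_conv m (\<lambda>i. \<alpha> i \<star> inf_conv m (\<lambda>k. ?w (n - m + i) k \<star> g k))"
        using False less.IH by (intro inf_conv_cong arg_cong[where f = "epi_mult _"]) auto
      also have "\<dots> = inf_conv m (\<lambda>k. (\<Sum>i<m. \<alpha> i * ?w (n - m + i) k) \<star> g k)"
        using \<alpha> recurrence_weight_nonneg Gamma c by (intro inf_conv_epi_mult_compose) auto
      also have "\<dots> = inf_conv m (\<lambda>k. ?w n k \<star> g k)"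
        using False by (simp add: recurrence_weight.simps[of m \<alpha> n])
      finally show ?thesis .
    qed
  qed
  have "epi_converges (\<lambda>n. inf_conv m (\<lambda>k. ?w n k \<star> g k)) (inf_conv m (\<lambda>k. lam m \<alpha> k \<star> g k))"
    using assms(5) super recurrence_weight_nonneg[OF \<alpha>(1)] recurrence_weight_tendsto_lam[OF \<alpha> assms(8)]
    by (intro epi_converges_inf_conv_epi_mult) auto
  moreover have "(\<lambda>n. inf_conv m (\<lambda>k. ?w n k \<star> g k)) = g"
    by (rule ext) (rule closed_form[symmetric])
  ultimately show ?thesis by (simp only:)
qed

end
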